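(* Let $k\geq 2$ be an integer. Then the group $\operatorname{Aut}_+({}^{b^k}\mathbb{R}^2)$ is isomorphic to the "$ax+b$ group" $\mathbb{R}_+\ltimes\mathbb{R}$. More precisely, it is generated by the following two 1-parameter subgroups: the vertical translations $(x,y)\mapsto (x,y+t)$, $t\in\mathbb{R}$, and the hyperbolic transformations $(x,y)\mapsto \left(e^{-\frac{t}{k-1}}x,\,e^{t}y\right)$, $t\in\mathbb{R}$.
   Context: For a positive integer $k$, let $L_k = x^k\partial_x + i\,\partial_y$, a smooth complex vector field on $\mathbb{R}^2$ with coordinates $(x,y)$, and let $\langle L_k\rangle$ be the $C^\infty(\mathbb{R}^2,\mathbb{C})$-module of complex vector fields generated by $L_k$, i.e. $\{fL_k : f\in C^\infty(\mathbb{R}^2,\mathbb{C})\}$. The standard $b^k$-complex plane is the pair ${}^{b^k}\mathbb{R}^2=(\mathbb{R}^2,\langle L_k\rangle)$. An automorphism of ${}^{b^k}\mathbb{R}^2$ is a ($C^\infty$) diffeomorphism $\theta:\mathbb{R}^2\to\mathbb{R}^2$ satisfying $\theta_*(\langle L_k\rangle)=\langle L_k\rangle$, where $\theta_*$ denotes the pushforward of vector fields, extended complex-linearly to complex vector fields. The automorphisms form a group $\operatorname{Aut}({}^{b^k}\mathbb{R}^2)$ under composition. Let $\mathbb{R}^2_+=\{(x,y)\in\mathbb{R}^2 : x>0\}$ be the open right half-plane; $\operatorname{Aut}_+({}^{b^k}\mathbb{R}^2)$ is the subgroup of those $\theta\in\operatorname{Aut}({}^{b^k}\mathbb{R}^2)$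 that preserve it, i.e. $\theta(\mathbb{R}^2_+)=\mathbb{R}^2_+$. The "$ax+b$ group" $\mathbb{R}_+\ltimes\mathbb{R}$ is the semidirect product in which the multiplicative group $\mathbb{R}_+$ of positive reals acts on the additive group $\mathbb{R}$ by multiplication; equivalently, it is the group of affine maps $s\mapsto as+b$ of $\mathbb{R}$ with $a>0$, $b\in\mathbb{R}$, under composition. *)

theory Defs
  imports "HOL-Analysis.Analysis" "HOL-Algebra.Generated_Groups"
begin

(* Since the domain is finite-dimensional, f is C^(n+1) iff it is differentiable and all its
   directional derivatives are C^n (n-fold directional derivatives are all required to be
   continuous). *)
primrec Ck :: "nat \<Rightarrow> ('a::euclidean_space \<Rightarrow> 'b::real_normed_vector) \<Rightarrow> bool" where
  "Ck 0 f \<longleftrightarrow> continuous_on UNIV f"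
| "Ck (Suc n) f \<longleftrightarrow> (\<forall>p. f differentiable (at p)) \<and>
     (\<forall>v. Ck n (\<lambda>p. frechet_derivative f (at p) v))"

definition smooth :: "('a::euclidean_space \<Rightarrow> 'b::real_normed_vector) \<Rightarrow> bool" where
  "smooth f \<longleftrightarrow> (\<forall>n. Ck n f)"

(* inv_into UNIV is the inverse function; the short form inv is the group inverse in HOL-Algebra. *)
definition diffeomorphism :: "('a::euclidean_space \<Rightarrow> 'a) \<Rightarrow> bool" where
  "diffeomorphism \<theta> \<longleftrightarrow> bij \<theta> \<and> smooth \<theta> \<and> smooth (inv_into UNIV \<theta>)"

(* The complex vector field a \<partial>x + b \<partial>y is represented by its coefficient function (a, b). *)
type_synonym cvector_field = "real \<times> real \<Rightarrow> complex \<times> complex"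

definition vf_scale :: "(real \<times> real \<Rightarrow> complex) \<Rightarrow> cvector_field \<Rightarrow> cvector_field" where
  "vf_scale f X = (\<lambda>p. (f p * fst (X p), f p * snd (X p)))"

definition vf_generated :: "cvector_field \<Rightarrow> cvector_field set" where
  "vf_generated X = {vf_scale f X | f. smooth f}"

(* The complex-linear extension A (u + i w) = A u + i A w of a real-linear map A. *)
definition complexify ::
  "(real \<times> real \<Rightarrow> real \<times> real) \<Rightarrow> complex \<times> complex \<Rightarrow> complex \<times> complex" where
  "complexify A c =
     (let u = A (Re (fst c), Re (snd c)); w = A (Im (fst c), Im (snd c))
      in (Complex (fst u) (fst w), Complex (snd u) (snd w)))"

definition pushforward :: "(real \<times> real \<Rightarrow> real \<times> real) \<Rightarrow> cvector_field \<Rightarrow> cvector_field" where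
  "pushforward \<theta> X =
     (\<lambda>q. complexify (frechet_derivative \<theta> (at (inv_into UNIV \<theta> q))) (X (inv_into UNIV \<theta> q)))"

definition bk_L :: "nat \<Rightarrow> cvector_field" where
  "bk_L k = (\<lambda>(x, y). (complex_of_real (x ^ k), \<i>))"

definition bk_automorphism :: "nat \<Rightarrow> (real \<times> real \<Rightarrow> real \<times> real) \<Rightarrow> bool" where
  "bk_automorphism k \<theta> \<longleftrightarrow>
     diffeomorphism \<theta> \<and> pushforward \<theta> ` vf_generated (bk_L k) = vf_generated (bk_L k)"

definition bk_Aut :: "nat \<Rightarrow> (real \<times> real \<Rightarrow> real \<times> real) monoid" where
  "bk_Aut k = \<lparr>carrier = {\<theta>. bk_automorphism k \<theta>}, mult = (\<circ>), one = id\<rparr>"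

definition right_half_plane :: "(real \<times> real) set" where
  "right_half_plane = {(x, y). x > 0}"

definition bk_Aut_plus :: "nat \<Rightarrow> (real \<times> real \<Rightarrow> real \<times> real) monoid" where
  "bk_Aut_plus k = (bk_Aut k)
     \<lparr>carrier := {\<theta> \<in> carrier (bk_Aut k). \<theta> ` right_half_plane = right_half_plane}\<rparr>"

(* The pair (a, b) stands for the affine map s \<mapsto> a s + b. *)
definition axb_group :: "(real \<times> real) monoid" where
  "axb_group = \<lparr>carrier = {0<..} \<times> UNIV,
     mult = (\<lambda>(a, b) (a', b'). (a * a', b + a * b')), one = (1, 0)\<rparr>"

definition real_additive_group :: "real monoid" where
  "real_additive_group = \<lparr>carrier = UNIV, mult = (+), one = 0\<rparr>"

definition vertical_translation :: "real \<Rightarrow> real \<times> real \<Rightarrow> real \<times> real" where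
  "vertical_translation t = (\<lambda>(x, y). (x, y + t))"

definition hyperbolic :: "nat \<Rightarrow> real \<Rightarrow> real \<times> real \<Rightarrow> real \<times> real" where
  "hyperbolic k t = (\<lambda>(x, y). (exp (- t / (real k - 1)) * x, exp t * y))"

end

(* For n = k - 1 the chart z = 1 / (n x^n) - i y identifies the half-plane x > 0 with Re z > 0
   and turns L_k into a multiple of the Cauchy-Riemann operator, while x \<rightarrow> 0+ corresponds to
   Re z \<rightarrow> \<infinity>.  Hence an automorphism that preserves x > 0 becomes a biholomorphism of the half-plane
   that fixes infinity, i.e. z \<mapsto> \<alpha> z + i \<beta> by Schwarz' lemma; in the coordinates (x, y) this is a
   hyperbolic transformation followed by a vertical translation.  The half-plane x < 0 reduces to
   x > 0 by the reflection (x, y) \<mapsto> (- x, (-1)^(k+1) y), which preserves L_k up to sign, and continuity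
   on the y-axis forces the parameters on the two sides to agree. *)

theory Submission
  imports Defs "HOL-Complex_Analysis.Complex_Analysis" "HOL-Real_Asymp.Real_Asymp"
begin

section \<open>Biholomorphisms of the right half-plane that fix infinity\<close>

lemma cayley_less_1: "norm ((z - 1) / (z + 1)) < 1" if "Re z > 0" for z :: complex
proof -
  have "z + 1 \<noteq> 0" using that by (auto simp: complex_eq_iff)
  have "(norm (z - 1))^2 < (norm (z + 1))^2"
    unfolding cmod_power2 using that by (simp add: power2_eq_square algebra_simps)
  then have "norm (z - 1) < norm (z + 1)"
    by (simp add: power2_less_imp_less)
  with \<open>z + 1 \<noteq> 0\<close> show ?thesis by (simp add: norm_divide)
qed

lemma inv_cayley_Re: "Re ((1 + w) / (1 - w)) > 0" if "norm w < 1" for w :: complex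
proof -
  have "w \<noteq> 1" using that by auto
  have "(Re w)^2 + (Im w)^2 < 1"
    using that abs_square_less_1[of "norm w"] by (simp add: cmod_power2)
  moreover have "(1 - Re w)\<^sup>2 + (Im w)\<^sup>2 > 0"
    using \<open>w \<noteq> 1\<close> by (auto simp: complex_eq_iff sum_power2_gt_zero_iff)
  ultimately show ?thesis
    by (simp add: Re_divide field_simps power2_eq_square)
qed

text \<open>The Cayley transform sends 1 to 0 and infinity to 1, so conjugating by it gives an
  automorphism of the unit disc that fixes 0. By Schwarz' lemma this is a rotation, and the boundary
  value at 1, approached along the real axis only, forces the rotation to be trivial.\<close>

lemma half_plane_automorphism_fixing_1_and_infinity:
  fixes G :: "complex \<Rightarrow> complex"
  assumes hol: "G holomorphic_on {z. Re z > 0}"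
    and bij: "bij_betw G {z. Re z > 0} {z. Re z > 0}"
    and G1: "G 1 = 1"
    and lim: "filterlim (\<lambda>r. G (of_real r)) at_infinity at_top"
    and z: "Re z > 0"
  shows "G z = z"
proof -
  define C :: "complex \<Rightarrow> complex" where "C z = (z - 1) / (z + 1)" for z
  define C' :: "complex \<Rightarrow> complex" where "C' w = (1 + w) / (1 - w)" for w
  let ?H = "{z::complex. Re z > 0}"
  have CC': "C (C' w) = w" if "norm w < 1" for w
  proof -
    have "1 - w \<noteq> 0" using that by auto
    then show ?thesis by (simp add: C_def C'_def divide_simps) 
  qed
  have C'C: "C' (C z) = z" if "Re z > 0" for z
  proof -
    have "z + 1 \<noteq> 0" using that by (auto simp: complex_eq_iff)
    then show ?thesis by (simp add: C_def C'_def divide_simps)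
  qed
  have C_less: "norm (C z) < 1" if "Re z > 0" for z
    using that cayley_less_1 by (simp add: C_def)
  have C'_Re: "Re (C' w) > 0" if "norm w < 1" for w
    using that inv_cayley_Re by (simp add: C'_def)
  have holC: "C holomorphic_on ?H"
    unfolding C_def by (intro holomorphic_intros) (auto simp: complex_eq_iff)
  have holC': "C' holomorphic_on ball 0 1"
    unfolding C'_def by (intro holomorphic_intros) auto
  have opH: "open ?H" by (rule open_halfspace_Re_gt)
  \<comment> \<open>An injective holomorphic map has a holomorphic inverse on its image; it supplies
    the second Schwarz inequality below.\<close>
  have "\<exists>G'. G' holomorphic_on G ` ?H \<and> (\<forall>z\<in>?H. G' (G z) = z)"
    by (rule holomorphic_has_inverse[OF hol opH bij_betw_imp_inj_on[OF bij]]) blast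
  then obtain G' where "G' holomorphic_on G ` ?H" "\<forall>z\<in>?H. G' (G z) = z" by blast
  then have G': "G' holomorphic_on ?H" "\<And>z. z \<in> ?H \<Longrightarrow> G' (G z) = z"
    unfolding bij_betw_imp_surj_on[OF bij] by simp_all
  have GH: "Re (G z) > 0" if "Re z > 0" for z
    using bij that unfolding bij_betw_def by blast
  have G'H: "Re (G' z) > 0 \<and> G (G' z) = z" if "Re z > 0" for z
  proof -
    have "z \<in> G ` ?H" using bij_betw_imp_surj_on[OF bij] that by simp
    then show ?thesis using G'(2) by auto
  qed
  have conj: "(\<lambda>w. C (K (C' w))) holomorphic_on ball 0 1"
    if "K holomorphic_on ?H" "\<And>z. Re z > 0 \<Longrightarrow> Re (K z) > 0" for K
  proof -
    have "(C \<circ> (K \<circ> C')) holomorphic_on ball 0 1"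
      by (rule holomorphic_on_compose_gen[OF holomorphic_on_compose_gen[OF holC' that(1)] holC])
        (use C'_Re that in auto)
    then show ?thesis by (simp add: o_def)
  qed
  define g where "g w = C (G (C' w))" for w
  define g' where "g' w = C (G' (C' w))" for w
  have holg: "g holomorphic_on ball 0 1" "g' holomorphic_on ball 0 1"
    unfolding g_def g'_def using conj[OF hol GH] conj[OF G'(1)] G'H by blast+
  have [simp]: "C 1 = 0" "C' 0 = 1" by (simp_all add: C_def C'_def)
  have G'1: "G' 1 = 1" using G'(2)[of 1] G1 by simp
  have g0: "g 0 = 0" "g' 0 = 0" by (simp_all add: g_def g'_def G1 G'1)
  have gl: "norm (g w) < 1" "norm (g' w) < 1" if "norm w < 1" for w
    using that C_less C'_Re GH G'H by (auto simp: g_def g'_def)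
  have g'g: "g' (g w) = w" if "norm w < 1" for w
    using that by (simp add: g_def g'_def C'C GH C'_Re G'(2) CC')
  \<comment> \<open>1/2 is just a nonzero point of the disc, at which the equality case of Schwarz'
    lemma can be invoked.\<close>
  have half: "norm (1/2::complex) < 1" by simp
  \<comment> \<open>Schwarz' lemma for \<open>g\<close> at \<open>w\<close> gives one inequality,
    and for the inverse \<open>g'\<close> at \<open>g w\<close> the other.\<close>
  have "norm (g w) = norm w" if "norm w < 1" for w
    using Schwarz_Lemma(1)[OF holg(1) g0(1) gl(1) that]
      Schwarz_Lemma(1)[OF holg(2) g0(2) gl(2) gl(1)[OF that]] g'g[OF that] by simp
  with half obtain \<alpha> where \<alpha>: "\<And>z. norm z < 1 \<Longrightarrow> g z = \<alpha> * z"
    using Schwarz_Lemma(3)[OF holg(1) g0(1) gl(1) half]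
    by (metis divide_eq_0_iff one_neq_zero zero_neq_numeral)
  have Clim: "(C \<longlongrightarrow> 1) at_infinity"
  proof -
    have "filterlim (\<lambda>z::complex. z + 1) at_infinity at_infinity"
      by (rule tendsto_add_filterlim_at_infinity'[OF filterlim_ident tendsto_const])
    then have "((\<lambda>z. 2 / (z + 1)) \<longlongrightarrow> (0::complex)) at_infinity"
      by (rule tendsto_divide_0[OF tendsto_const])
    then have "((\<lambda>z. 1 - 2 / (z + 1)) \<longlongrightarrow> (1 - 0::complex)) at_infinity"
      by (rule tendsto_diff[OF tendsto_const])
    moreover have "\<forall>\<^sub>F z::complex in at_infinity. 1 - 2 / (z + 1) = C z"
      using eventually_not_equal_at_infinity[of "-1"]
    proof eventually_elim
      case (elim z)
      then have "z + 1 \<noteq> 0" by (simp add: eq_neg_iff_add_eq_0)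
      then show ?case by (simp add: C_def divide_simps)
    qed
    ultimately show ?thesis by (simp add: tendsto_cong)
  qed
  \<comment> \<open>Along r \<rightarrow> \<infinity> the same function tends to 1 by
    \<open>lim\<close> and to \<alpha> because \<open>g\<close> is multiplication by \<alpha>; hence
    \<alpha> = 1.\<close>
  have "((\<lambda>r::real. C (G (of_real r))) \<longlongrightarrow> 1) at_top"
    by (rule filterlim_compose[OF Clim lim])
  moreover have "\<forall>\<^sub>F r::real in at_top. C (G (of_real r)) = \<alpha> * C (of_real r)"
    using eventually_gt_at_top[of 0]
  proof eventually_elim
    case (elim r)
    then show ?case using \<alpha>[of "C (of_real r)"] C_less[of "of_real r"] C'C[of "of_real r"]
      by (simp add: g_def)
  qed
  ultimately have "((\<lambda>r::real. \<alpha> * C (of_real r)) \<longlongrightarrow> 1) at_top"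
    by (simp add: tendsto_cong)
  moreover have "((\<lambda>r::real. \<alpha> * C (of_real r)) \<longlongrightarrow> \<alpha> * 1) at_top"
    by (intro tendsto_mult tendsto_const filterlim_compose[OF Clim] filterlim_of_real_at_infinity)
  ultimately have "\<alpha> = 1"
    using tendsto_unique[OF trivial_limit_at_top_linorder] by fastforce
  then have "C (G z) = C z"
    using \<alpha>[OF C_less[OF z]] z by (simp add: g_def C'C)
  then show ?thesis using C'C z GH by metis
qed

text \<open>The maps z \<mapsto> \<alpha> z + i \<beta> with \<alpha> > 0 act transitively on the
  half-plane and fix infinity, so composing with the inverse of a suitable one reduces to the case
  where 1 is fixed.\<close>

lemma half_plane_automorphism_fixing_infinity:
  fixes F :: "complex \<Rightarrow> complex"
  assumes hol: "F holomorphic_on {z. Re z > 0}"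
    and bij: "bij_betw F {z. Re z > 0} {z. Re z > 0}"
    and lim: "filterlim (\<lambda>r. F (of_real r)) at_infinity at_top"
  shows "\<exists>\<alpha> \<beta> :: real. \<alpha> > 0 \<and> (\<forall>z. Re z > 0 \<longrightarrow> F z = of_real \<alpha> * z + \<i> * of_real \<beta>)"
proof -
  \<comment> \<open>These values are dictated by the normalisation \<open>G 1 = 1\<close>.\<close>
  define \<alpha> \<beta> where "\<alpha> = Re (F 1)" and "\<beta> = Im (F 1)"
  have "\<alpha> > 0" using bij unfolding \<alpha>_def bij_betw_def by force
  have F1: "F 1 = of_real \<alpha> + \<i> * of_real \<beta>" by (simp add: \<alpha>_def \<beta>_def complex_eq_iff)
  define G where "G z = (F z - \<i> * of_real \<beta>) / of_real \<alpha>" for z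
  have "bij_betw (\<lambda>z. (z - \<i> * of_real \<beta>) / of_real \<alpha>) {z. Re z > 0} {z. Re z > 0}"
    by (rule bij_betw_byWitness[where f' = "\<lambda>z. of_real \<alpha> * z + \<i> * of_real \<beta>"])
      (use \<open>\<alpha> > 0\<close> in \<open>auto simp: field_simps\<close>)
  from bij_betw_trans[OF bij this] have bijG: "bij_betw G {z. Re z > 0} {z. Re z > 0}"
    by (simp add: G_def[abs_def] o_def)
  have "filterlim (\<lambda>r::real. F (of_real r) + (- (\<i> * of_real \<beta>))) at_infinity at_top"
    by (rule tendsto_add_filterlim_at_infinity'[OF lim tendsto_const])
  from tendsto_mult_filterlim_at_infinity[OF tendsto_const _ this, of "inverse (of_real \<alpha>)"]
  have limG: "filterlim (\<lambda>r. G (of_real r)) at_infinity at_top"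
    using \<open>\<alpha> > 0\<close> by (simp add: G_def divide_inverse mult.commute)
  have "G holomorphic_on {z. Re z > 0}"
    unfolding G_def by (intro holomorphic_intros hol) (use \<open>\<alpha> > 0\<close> in auto)
  then have "G z = z" if "Re z > 0" for z
    by (rule half_plane_automorphism_fixing_1_and_infinity[OF _ bijG _ limG that])
      (use \<open>\<alpha> > 0\<close> in \<open>auto simp: G_def F1\<close>)
  with \<open>\<alpha> > 0\<close> have "F z = of_real \<alpha> * z + \<i> * of_real \<beta>" if "Re z > 0" for z
    using that by (simp add: G_def field_simps)
  with \<open>\<alpha> > 0\<close> show ?thesis by blast
qed

section \<open>The two-parameter family: a hyperbolic transformation followed by a vertical
  translation\<close>

definition affine_auto :: "nat \<Rightarrow> real \<Rightarrow> real \<Rightarrow> real \<times> real \<Rightarrow> real \<times> real" where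
  "affine_auto k t b = (\<lambda>(x, y). (exp (- t / (real k - 1)) * x, exp t * y + b))"

text \<open>On the pairs \<open>(exp t, b)\<close> this is the multiplication of the ax+b group,
  while the exponent of the x-scaling is linear in t and simply adds up.\<close>

lemma affine_auto_comp:
  "affine_auto k t b \<circ> affine_auto k t' b' = affine_auto k (t + t') (b + exp t * b')"
proof -
  have "exp (- (t + t') / (real k - 1)) = exp (- t / (real k - 1)) * exp (- t' / (real k - 1))"
    unfolding exp_add[symmetric] by (rule arg_cong[of _ _ exp]) (simp add: diff_divide_distrib)
  then show ?thesis
    by (simp add: affine_auto_def fun_eq_iff exp_add distrib_left)
qed

lemma affine_auto_0: "affine_auto k 0 0 = id"
  by (auto simp: affine_auto_def)

lemma affine_auto_inverse:
  "affine_auto k t b (affine_auto k (- t) (- (exp (- t) * b)) p) = p"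
  "affine_auto k (- t) (- (exp (- t) * b)) (affine_auto k t b p) = p"
  by (auto simp: affine_auto_def exp_minus field_simps split: prod.splits)

lemma bij_affine_auto: "bij (affine_auto k t b)"
  by (rule o_bij[of "affine_auto k (- t) (- (exp (- t) * b))"])
    (simp_all add: fun_eq_iff affine_auto_inverse)

lemma inv_affine_auto:
  "inv_into UNIV (affine_auto k t b) = affine_auto k (- t) (- (exp (- t) * b))"
  by (rule inv_unique_comp) (simp_all add: fun_eq_iff affine_auto_inverse)

text \<open>The linear part of \<open>affine_auto k t b\<close>, and thus its derivative at every
  point.\<close>

definition affine_auto_linear :: "nat \<Rightarrow> real \<Rightarrow> real \<times> real \<Rightarrow> real \<times> real" where
  "affine_auto_linear k t = (\<lambda>p. (exp (- t / (real k - 1)) * fst p, exp t * snd p))"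

lemma affine_auto_eq: "affine_auto k t b p = affine_auto_linear k t p + (0, b)"
  by (cases p) (simp add: affine_auto_def affine_auto_linear_def)

lemma bounded_linear_affine_auto_linear: "bounded_linear (affine_auto_linear k t)"
  unfolding affine_auto_linear_def
  by (intro bounded_linear_Pair bounded_linear_const_mult bounded_linear_fst bounded_linear_snd)

lemma has_derivative_affine_auto:
  "(affine_auto k t b has_derivative affine_auto_linear k t) (at p)"
  unfolding affine_auto_eq[abs_def]
  using has_derivative_add[OF bounded_linear_imp_has_derivative[OF bounded_linear_affine_auto_linear] has_derivative_const]
  by force

section \<open>Closure properties of \<open>Ck\<close> and smoothness of the family\<close>

lemma Ck_continuous_on: "Ck n f \<Longrightarrow> continuous_on UNIV f"
  by (cases n) (auto intro!: continuous_at_imp_continuous_on differentiable_imp_continuous_within)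

lemma Ck_const: "Ck n (\<lambda>p. c)"
proof (induction n arbitrary: c)
  case (Suc n)
  have "frechet_derivative (\<lambda>p. c) (at p) = (\<lambda>v. 0)" for p :: 'a
    by (rule frechet_derivative_at[symmetric]) (rule has_derivative_const)
  with Suc show ?case by simp
qed simp

text \<open>The directional derivatives of A \<circ> f are A composed with those of f, so the
  induction on n goes through once f is generalised.\<close>

lemma Ck_linear_comp:
  assumes "bounded_linear A"
  shows "Ck n f \<Longrightarrow> Ck n (\<lambda>p. A (f p))"
proof (induction n arbitrary: f)
  case 0
  then show ?case using bounded_linear.continuous_on[OF assms] by simp
next
  case (Suc n)
  have "((\<lambda>p. A (f p)) has_derivative (\<lambda>v. A (frechet_derivative f (at p) v))) (at p)" for p
    using Suc.prems by (intro bounded_linear.has_derivative[OF assms])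
      (simp add: frechet_derivative_works[symmetric])
  note d = this this[THEN frechet_derivative_at, symmetric]
  show ?case using Suc unfolding Ck.simps d(2) by (auto simp: differentiable_def intro: d(1))
qed

text \<open>The derivative of the composite along v is the derivative of f along A v, composed with
  the same affine map; hence the induction hypothesis applies to the directional derivatives of
  f.\<close>

lemma Ck_comp_affine:
  assumes "bounded_linear A"
  shows "Ck n f \<Longrightarrow> Ck n (\<lambda>p. f (A p + c))"
proof (induction n arbitrary: f)
  case 0
  then show ?case
    using continuous_on_compose2[of UNIV f UNIV "\<lambda>p. A p + c"]
    by (simp add: continuous_on_add bounded_linear.continuous_on[OF assms] continuous_on_id)
next
  case (Suc n)
  have "((\<lambda>p. f (A p + c)) has_derivative
      (\<lambda>v. frechet_derivative f (at (A p + c)) (A v))) (at p)" for p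
  proof -
    have "((\<lambda>p. A p + c) has_derivative A) (at p)"
      using has_derivative_add[OF bounded_linear_imp_has_derivative[OF assms] has_derivative_const]
      by force
    moreover have "(f has_derivative frechet_derivative f (at (A p + c))) (at (A p + c))"
      using Suc.prems by (simp add: frechet_derivative_works[symmetric])
    ultimately show ?thesis by (rule has_derivative_compose)
  qed
  note d = this this[THEN frechet_derivative_at, symmetric]
  show ?case using Suc unfolding Ck.simps d(2) by (auto simp: differentiable_def intro: d(1))
qed

lemma Ck_id: "Ck n (\<lambda>p. p)"
proof (cases n)
  case (Suc m)
  have "frechet_derivative (\<lambda>p. p) (at p) = (\<lambda>v. v)" for p :: 'a
    by (rule frechet_derivative_at[symmetric]) (rule has_derivative_ident)
  with Suc show ?thesis by (simp add: Ck_const)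
qed (simp add: continuous_on_id)

lemma smooth_affine_auto: "smooth (affine_auto k t b)"
  unfolding smooth_def affine_auto_eq[abs_def]
  using Ck_comp_affine[OF bounded_linear_affine_auto_linear Ck_id] by blast

lemma smooth_comp_affine_auto: "smooth f \<Longrightarrow> smooth (\<lambda>p. f (affine_auto k t b p))"
  unfolding smooth_def affine_auto_eq
  using Ck_comp_affine[OF bounded_linear_affine_auto_linear] by blast

lemma smooth_mult_left: "smooth f \<Longrightarrow> smooth (\<lambda>p. c * f p)" for c :: complex
  unfolding smooth_def using Ck_linear_comp[OF bounded_linear_mult_right] by blast

section \<open>The family consists of automorphisms preserving the half-plane\<close>

lemma complexify_affine_auto_linear:
  "complexify (affine_auto_linear k t) c =
    (of_real (exp (- t / (real k - 1))) * fst c, of_real (exp t) * snd c)"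
  by (simp add: complexify_def affine_auto_linear_def Let_def complex_eq_iff del: exp_of_real)

text \<open>The derivative scales the x-coefficient by s = exp (-t/(k-1)) and the y-coefficient by
  exp t, while x^k at the image point becomes s^k x^k. Since s^(k-1) = exp (-t), we have exp t * s^k
  = s, so both coefficients of L_k change by the same factor exp t. This identity explains the
  exponent -t/(k-1).\<close>

lemma pushforward_affine_auto:
  assumes "k \<ge> 2"
  shows "pushforward (affine_auto k t b) (vf_scale f (bk_L k)) =
    vf_scale (\<lambda>q. of_real (exp t) * f (inv_into UNIV (affine_auto k t b) q)) (bk_L k)"
proof
  fix q :: "real \<times> real"
  define s where "s = exp (- t / (real k - 1))"
  define p where "p = inv_into UNIV (affine_auto k t b) q"
  have q: "q = affine_auto k t b p"
    using bij_affine_auto by (metis p_def bij_inv_eq_iff)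
  have s: "exp t * s ^ k = s"
  proof -
    have "s ^ (k - 1) = exp (- t)"
      using assms by (simp add: s_def exp_of_nat_mult[symmetric] of_nat_diff)
    moreover have "s ^ k = s * s ^ (k - 1)"
      using assms by (cases k) auto
    ultimately show ?thesis by (simp add: exp_minus)
  qed
  have D: "frechet_derivative (affine_auto k t b) (at p) = affine_auto_linear k t"
    by (rule frechet_derivative_at[OF has_derivative_affine_auto, symmetric])
  have "of_real (exp t) * (of_real (s * x) :: complex) ^ k = of_real (exp t * s ^ k * x ^ k)" for x
    by (simp only: of_real_mult of_real_power power_mult_distrib mult.assoc)
  then have s': "of_real (exp t) * (of_real (s * x) :: complex) ^ k = of_real s * of_real x ^ k" for x
    by (simp only: s of_real_mult of_real_power)
  have "pushforward (affine_auto k t b) (vf_scale f (bk_L k)) q =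
      (of_real s * (f p * of_real (fst p) ^ k), of_real (exp t) * (f p * \<i>))"
    by (simp only: pushforward_def vf_scale_def bk_L_def p_def[symmetric] D
        complexify_affine_auto_linear s_def split_beta fst_conv snd_conv of_real_power)
  also have "\<dots> = (of_real (exp t) * f p * of_real (s * fst p) ^ k, of_real (exp t) * f p * \<i>)"
    using s'[of "fst p"] by (simp only: mult.assoc mult.left_commute[of _ "f p"])
  also have "\<dots> = vf_scale (\<lambda>q. of_real (exp t) * f (inv_into UNIV (affine_auto k t b) q)) (bk_L k) q"
    unfolding vf_scale_def p_def[symmetric]
    by (simp only: q affine_auto_def bk_L_def s_def split_beta fst_conv snd_conv of_real_power)
  finally show "pushforward (affine_auto k t b) (vf_scale f (bk_L k)) q =
    vf_scale (\<lambda>q. of_real (exp t) * f (inv_into UNIV (affine_auto k t b) q)) (bk_L k) q" .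
qed

lemma bk_automorphism_affine_auto:
  assumes "k \<ge> 2"
  shows "bk_automorphism k (affine_auto k t b)"
proof -
  let ?\<phi> = "affine_auto k t b"
  have "smooth (\<lambda>q. of_real (exp t) * f (inv_into UNIV ?\<phi> q))" if "smooth f" for f :: "real \<times> real \<Rightarrow> complex"
    unfolding inv_affine_auto by (intro smooth_mult_left smooth_comp_affine_auto that)
  then have "pushforward ?\<phi> ` vf_generated (bk_L k) \<subseteq> vf_generated (bk_L k)"
    by (auto simp: vf_generated_def pushforward_affine_auto[OF assms])
  moreover have "vf_scale g (bk_L k) \<in> pushforward ?\<phi> ` vf_generated (bk_L k)" if "smooth g" for g
  proof -
    \<comment> \<open>Obtained by solving the pushforward formula for the coefficient whose image is
      g.\<close>
    let ?f = "\<lambda>p. of_real (exp (- t)) * g (?\<phi> p)"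
    have "smooth ?f" by (intro smooth_mult_left smooth_comp_affine_auto that)
    moreover have "pushforward ?\<phi> (vf_scale ?f (bk_L k)) = vf_scale g (bk_L k)"
      unfolding pushforward_affine_auto[OF assms] inv_affine_auto affine_auto_inverse
      by (simp add: mult.assoc[symmetric] exp_minus flip: exp_of_real)
    ultimately show ?thesis unfolding vf_generated_def by (metis (mono_tags, lifting) image_eqI mem_Collect_eq)
  qed
  then have "vf_generated (bk_L k) \<subseteq> pushforward ?\<phi> ` vf_generated (bk_L k)"
    by (auto simp: vf_generated_def)
  ultimately show ?thesis
    by (simp add: bk_automorphism_def diffeomorphism_def bij_affine_auto smooth_affine_auto inv_affine_auto)
qed

lemma affine_auto_right_half_plane:
  "affine_auto k t b ` right_half_plane = right_half_plane"
proof -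
  \<comment> \<open>Stated for all parameters, so that it also covers the inverse map and thereby
    gives the opposite inclusion.\<close>
  have sub: "affine_auto k t b ` right_half_plane \<subseteq> right_half_plane" for t b
    by (auto simp: affine_auto_def right_half_plane_def)
  show ?thesis
  proof
    show "right_half_plane \<subseteq> affine_auto k t b ` right_half_plane"
    proof
      fix p assume "p \<in> right_half_plane"
      then have "affine_auto k (- t) (- (exp (- t) * b)) p \<in> right_half_plane"
        using sub by blast
      from imageI[OF this, of "affine_auto k t b"] show "p \<in> affine_auto k t b ` right_half_plane"
        by (simp only: affine_auto_inverse)
    qed
  qed (rule sub)
qed

section \<open>Rigidity on one half-plane\<close>

text \<open>\<open>CR1\<close> and \<open>CR2\<close> together say that D p maps L_k at p to a
  complex multiple of L_k at \<theta> p, and \<open>lim\<close> makes the conjugated map fix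
  infinity. The hypotheses concern only x > 0, so that the lemma also serves for the reflected
  restriction to the left half-plane.\<close>

lemma affine_auto_on_right_half_plane:
  fixes \<theta> :: "real \<times> real \<Rightarrow> real \<times> real"
  assumes k: "k \<ge> 2"
    and bij: "bij_betw \<theta> right_half_plane right_half_plane"
    and deriv: "\<And>p. p \<in> right_half_plane \<Longrightarrow> (\<theta> has_derivative D p) (at p)"
    and CR1: "\<And>p. p \<in> right_half_plane \<Longrightarrow>
      fst (D p (fst p ^ k, 0)) = fst (\<theta> p) ^ k * snd (D p (0, 1))"
    and CR2: "\<And>p. p \<in> right_half_plane \<Longrightarrow>
      fst (D p (0, 1)) = - (fst (\<theta> p) ^ k) * snd (D p (fst p ^ k, 0))"
    and lim: "((\<lambda>x. fst (\<theta> (x, 0))) \<longlongrightarrow> 0) (at_right 0)"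
  obtains t b where "\<And>p. p \<in> right_half_plane \<Longrightarrow> \<theta> p = affine_auto k t b p"
proof -
  define n where "n = k - 1"
  have n: "n > 0" "k = Suc n" using k by (auto simp: n_def)
  let ?R = right_half_plane and ?H = "{z::complex. Re z > 0}"
  have R_iff: "p \<in> ?R \<longleftrightarrow> fst p > 0" for p
    by (cases p) (simp add: right_half_plane_def)
  have \<theta>_pos: "fst (\<theta> p) > 0" if "fst p > 0" for p
    using bij that R_iff unfolding bij_betw_def by blast
  \<comment> \<open>For x, r > 0, \<open>X\<close> inverts x \<mapsto> 1/(n x^n). \<open>W\<close>
    is the chart to the complex half-plane and \<open>V\<close> its inverse.\<close>
  define X where "X r = root n (1 / (real n * r))" for r
  define W :: "real \<times> real \<Rightarrow> complex"
    where "W p = of_real (1 / (real n * fst p ^ n)) - \<i> * of_real (snd p)" for p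
  define V :: "complex \<Rightarrow> real \<times> real" where "V z = (X (Re z), - Im z)" for z
  have X_pos: "X r > 0" if "r > 0" for r
    using that n by (simp add: X_def)
  have X_pow: "X r ^ n = 1 / (real n * r)" if "r > 0" for r
    using that n by (simp add: X_def)
  have WV: "W (V z) = z" if "Re z > 0" for z
    using that n by (simp add: W_def V_def X_pow complex_eq_iff)
  have VW: "V (W p) = p" if "fst p > 0" for p
    using that n by (simp add: W_def V_def X_def real_root_power_cancel)
  have bijV: "bij_betw V ?H ?R"
    by (rule bij_betw_byWitness[where f' = W])
      (use WV VW n in \<open>auto simp: R_iff V_def W_def X_pos\<close>)
  have bijW: "bij_betw W ?R ?H"
    by (rule bij_betw_byWitness[where f' = V])
      (use WV VW n in \<open>auto simp: R_iff V_def W_def X_pos\<close>)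
  define F where "F z = W (\<theta> (V z))" for z
  have bijF: "bij_betw F ?H ?H"
    using bij_betw_trans[OF bij_betw_trans[OF bijV bij] bijW] by (simp add: F_def[abs_def] o_def)
  \<comment> \<open>The derivative of 1/(n x^n) is -1/x^k, which is why the chart carries the factor
    1/n: x^k \<partial>x becomes minus the derivative in Re z.\<close>
  have dX: "(X has_field_derivative - (X r ^ k)) (at r)" if "r > 0" for r
  proof -
    have "((\<lambda>r. 1 / (real n * r)) has_field_derivative - (1 / (real n * r\<^sup>2))) (at r)"
      using that n by (auto intro!: derivative_eq_intros simp: power2_eq_square)
    from DERIV_chain2[OF DERIV_real_root this, of n] that n
    have "(X has_field_derivative
        inverse (real n * X r ^ (n - Suc 0)) * - (1 / (real n * r\<^sup>2))) (at r)"
      by (simp add: X_def[abs_def])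
    moreover have "1 / (real n * r\<^sup>2) = real n * (X r ^ n)\<^sup>2"
      using that n by (simp add: X_pow power2_eq_square)
    moreover have "inverse (real n * X r ^ (n - Suc 0)) * (real n * (X r ^ n)\<^sup>2) = X r ^ k"
    proof -
      have sq: "(X r ^ n)\<^sup>2 = X r ^ (n - Suc 0) * X r ^ k"
        using n(1) unfolding n(2) by (simp add: mult_2_right flip: power_mult power_add power_Suc)
      have "inverse (c * a) * (c * (a * b)) = b" if "a \<noteq> 0" "c \<noteq> 0" for a b c :: real
        using that by (simp add: field_simps)
      then show ?thesis
        unfolding sq using n(1) X_pos[OF that] by (metis less_irrefl of_nat_0_less_iff zero_less_power)
    qed
    ultimately show ?thesis by simp
  qed
  have dV: "(V has_derivative (\<lambda>h. (- (X (Re z) ^ k) * Re h, - Im h))) (at z)" if "Re z > 0" for z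
  proof -
    have "((\<lambda>z. X (Re z)) has_derivative (\<lambda>h. Re h * - (X (Re z) ^ k))) (at z)"
      by (rule DERIV_compose_FDERIV[where g = Re and x = z, OF dX[OF that]])
        (rule bounded_linear_imp_has_derivative[OF bounded_linear_Re])
    moreover have "((\<lambda>z. - Im z) has_derivative (\<lambda>h. - Im h)) (at z)"
      by (intro has_derivative_minus bounded_linear_imp_has_derivative[OF bounded_linear_Im])
    ultimately show ?thesis
      unfolding V_def using has_derivative_Pair by (fastforce simp: mult.commute)
  qed
  have dW: "(W has_derivative (\<lambda>v. of_real (- fst v / fst p ^ k) - \<i> * of_real (snd v))) (at p)"
    if "fst p > 0" for p
  proof -
    have "((\<lambda>x. 1 / (real n * x ^ n)) has_field_derivative - (1 / fst p ^ k)) (at (fst p))"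
    proof -
      have "((\<lambda>x. real n * x ^ n) has_field_derivative real n * (real n * fst p ^ (n - Suc 0))) (at (fst p))"
        by (auto intro!: derivative_eq_intros)
      then have "((\<lambda>x. inverse (real n * x ^ n)) has_field_derivative
          - (real n * (real n * fst p ^ (n - Suc 0)) * inverse ((real n * fst p ^ n) ^ Suc (Suc 0)))) (at (fst p))"
        using that n(1) by (intro DERIV_inverse_fun) auto
      moreover have "c * (c * q) * inverse ((c * (a * q)) ^ Suc (Suc 0)) = 1 / (a * (a * q))"
        if "c \<noteq> 0" "a \<noteq> 0" "q \<noteq> 0" for a c q :: real
        using that by (simp add: field_simps)
      note this[of "real n" "fst p" "fst p ^ (n - Suc 0)"]
      moreover have "fst p ^ n = fst p * fst p ^ (n - Suc 0)"
        using n(1) by (simp flip: power_Suc)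
      ultimately show ?thesis
        using that n by (simp add: inverse_eq_divide)
    qed
    then have "((\<lambda>p. 1 / (real n * fst p ^ n)) has_derivative (\<lambda>v. fst v * - (1 / fst p ^ k))) (at p)"
      by (rule DERIV_compose_FDERIV) (rule bounded_linear_imp_has_derivative[OF bounded_linear_fst])
    then have "(W has_derivative (\<lambda>v. of_real (fst v * - (1 / fst p ^ k)) - \<i> * of_real (snd v))) (at p)"
      unfolding W_def
      by (intro has_derivative_diff has_derivative_of_real has_derivative_mult_right
          bounded_linear_imp_has_derivative[OF bounded_linear_snd])
    then show ?thesis by simp
  qed
  have dF: "\<exists>c. (F has_field_derivative c) (at z)" if "Re z > 0" for z
  proof -
    define p where "p = V z"
    have p: "p \<in> ?R" "fst p > 0" "fst p = X (Re z)"
      using that by (simp_all add: p_def V_def R_iff X_pos)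
    define A1 A2 where "A1 = D p (fst p ^ k, 0)" and "A2 = D p (0, 1)"
    let ?P = "fst (\<theta> p)"
    have P: "?P > 0" by (rule \<theta>_pos[OF p(2)])
    interpret D: linear "D p"
      using has_derivative_linear[OF deriv[OF p(1)]] .
    have "(F has_derivative (\<lambda>h. of_real (- fst (D p (- (X (Re z) ^ k) * Re h, - Im h)) / ?P ^ k)
         - \<i> * of_real (snd (D p (- (X (Re z) ^ k) * Re h, - Im h))))) (at z)"
      unfolding F_def p_def
      by (rule has_derivative_compose[OF has_derivative_compose[OF dV[OF that] deriv] dW])
        (use p P in \<open>simp_all add: p_def\<close>)
    \<comment> \<open>The complex factor is the value of the derivative at h = 1; the two
      Cauchy-Riemann relations make its value at h = i equal to i times that factor, so the
      real-linear derivative is complex-linear.\<close>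
    moreover have "of_real (- fst (D p (- (X (Re z) ^ k) * Re h, - Im h)) / ?P ^ k)
         - \<i> * of_real (snd (D p (- (X (Re z) ^ k) * Re h, - Im h)))
         = Complex (fst A1 / ?P ^ k) (snd A1) * h" for h
    proof -
      \<comment> \<open>Decomposition into the two vectors on which \<open>CR1\<close> and
        \<open>CR2\<close> control D p.\<close>
      have "(- (X (Re z) ^ k) * Re h, - Im h) = (- Re h) *\<^sub>R (fst p ^ k, 0) + (- Im h) *\<^sub>R (0, 1)"
        by (simp add: p)
      then have D_eq: "D p (- (X (Re z) ^ k) * Re h, - Im h) = (- Re h) *\<^sub>R A1 + (- Im h) *\<^sub>R A2"
        by (simp only: D.add D.scale A1_def A2_def)
      have "fst A1 = ?P ^ k * snd A2" "fst A2 = - (?P ^ k) * snd A1"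
        using CR1[OF p(1)] CR2[OF p(1)] by (simp_all add: A1_def A2_def)
      then show ?thesis
        unfolding D_eq using P by (simp add: complex_eq_iff field_simps)
    qed
    ultimately show ?thesis unfolding has_field_derivative_def by (auto simp: fun_eq_iff)
  qed
  have holF: "F holomorphic_on ?H"
    using dF by (auto simp: holomorphic_on_def field_differentiable_def
        intro: has_field_derivative_at_within)
  \<comment> \<open>X r tends to 0 through positive values, so the one-sided limit
    \<open>lim\<close> can be composed with it.\<close>
  have limX: "filterlim X (at_right 0) at_top"
  proof -
    have "((\<lambda>r. 1 / (real n * r)) \<longlongrightarrow> 0) at_top"
      using n(1) by real_asymp
    from tendsto_real_root[OF this, of n] have "(X \<longlongrightarrow> 0) at_top" by (simp add: X_def[abs_def])
    moreover have "\<forall>\<^sub>F r in at_top. X r \<in> {0<..} \<and> X r \<noteq> 0"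
      using eventually_gt_at_top[of 0] by eventually_elim (use X_pos in force)
    ultimately show ?thesis by (simp add: filterlim_at)
  qed
  have limF: "filterlim (\<lambda>r. F (of_real r)) at_infinity at_top"
  proof -
    let ?P = "\<lambda>r. fst (\<theta> (X r, 0))"
    have "(?P \<longlongrightarrow> 0) at_top" by (rule filterlim_compose[OF lim limX])
    then have "((\<lambda>r. real n * ?P r ^ n) \<longlongrightarrow> real n * 0 ^ n) at_top"
      by (intro tendsto_intros)
    then have "((\<lambda>r. real n * ?P r ^ n) \<longlongrightarrow> 0) at_top"
      using n(1) by (simp only: zero_power mult_zero_right)
    moreover have "\<forall>\<^sub>F r in at_top. real n * ?P r ^ n > 0"
      using eventually_gt_at_top[of 0] by eventually_elim (use n \<theta>_pos X_pos in simp)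
    ultimately have "filterlim (\<lambda>r. inverse (real n * ?P r ^ n)) at_top at_top"
      by (rule filterlim_inverse_at_top)
    \<comment> \<open>The real part of F r is exactly 1/(n x^n) at the image point, which blows up
      because x tends to 0 there.\<close>
    moreover have "\<forall>\<^sub>F r in at_top. inverse (real n * ?P r ^ n) \<le> norm (F (of_real r))"
    proof (rule always_eventually, rule allI)
      fix r
      have "inverse (real n * ?P r ^ n) = Re (F (of_real r))"
        by (simp add: F_def W_def V_def inverse_eq_divide)
      then show "inverse (real n * ?P r ^ n) \<le> norm (F (of_real r))"
        using complex_Re_le_cmod by metis
    qed
    ultimately show ?thesis
      unfolding filterlim_at_infinity_conv_norm_at_top by (rule filterlim_at_top_mono)
  qed
  obtain \<alpha> \<beta> :: real where \<alpha>: "\<alpha> > 0"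
    and F: "\<And>z. Re z > 0 \<Longrightarrow> F z = of_real \<alpha> * z + \<i> * of_real \<beta>"
    using half_plane_automorphism_fixing_infinity[OF holF bijF limF] by blast
  show thesis
  \<comment> \<open>The y-scaling exp t has to be \<alpha>, and the translation changes sign because
    the chart has imaginary part -y.\<close>
  proof (rule that[of "ln \<alpha>" "- \<beta>"])
    fix p assume "p \<in> ?R"
    then have p: "fst p > 0" by (simp add: R_iff)
    let ?P = "fst (\<theta> p)" and ?s = "exp (- ln \<alpha> / real n)"
    have "Re (W p) > 0" using p n by (simp add: W_def)
    from F[OF this] have W: "W (\<theta> p) = of_real \<alpha> * W p + \<i> * of_real \<beta>"
      by (simp add: F_def VW p)
    \<comment> \<open>The real part determines the n-th power of the new x-coordinate; taking the
      positive root gives the scaling \<alpha>^(-1/n) = exp (- ln \<alpha> / (k-1)).\<close>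
    have "1 / (real n * ?P ^ n) = \<alpha> / (real n * fst p ^ n)"
      using arg_cong[OF W, of Re] by (simp add: W_def)
    then have "?P ^ n = fst p ^ n / \<alpha>"
      using n(1) p \<theta>_pos[OF p] \<alpha> by (simp add: field_simps)
    also have "\<dots> = (?s * fst p) ^ n"
    proof -
      have "?s ^ n = exp (real n * (- ln \<alpha> / real n))" by (simp only: exp_of_nat_mult)
      also have "\<dots> = 1 / \<alpha>" using n(1) \<alpha> by (simp add: exp_minus inverse_eq_divide)
      finally show ?thesis by (simp add: power_mult_distrib)
    qed
    finally have P_pow: "?P ^ n = (?s * fst p) ^ n" .
    have "?P = ?s * fst p"
      by (rule power_eq_imp_eq_base[OF P_pow less_imp_le[OF \<theta>_pos[OF p]] _ n(1)])
        (rule mult_nonneg_nonneg[OF exp_ge_zero less_imp_le[OF p]])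
    moreover have "snd (\<theta> p) = \<alpha> * snd p - \<beta>"
      using arg_cong[OF W, of Im] by (simp add: W_def)
    ultimately show "\<theta> p = affine_auto k (ln \<alpha>) (- \<beta>) p"
      using \<alpha> by (simp add: affine_auto_def split_beta prod_eq_iff n(2))
  qed
qed

section \<open>Cauchy-Riemann relations of an automorphism and its behaviour at the y-axis\<close>

lemma bk_automorphism_CR:
  assumes "bk_automorphism k \<theta>"
  defines "D \<equiv> \<lambda>p. frechet_derivative \<theta> (at p)"
  shows "fst (D p (fst p ^ k, 0)) = fst (\<theta> p) ^ k * snd (D p (0, 1))"
    and "fst (D p (0, 1)) = - (fst (\<theta> p) ^ k) * snd (D p (fst p ^ k, 0))"
proof -
  have "bij \<theta>" using assms by (simp add: bk_automorphism_def diffeomorphism_def)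
  then have inv: "inv_into UNIV \<theta> (\<theta> p) = p" by (simp add: bij_is_inj)
  \<comment> \<open>It suffices to push forward the generator itself, that is, the coefficient
    function 1.\<close>
  have "smooth (\<lambda>p. 1 :: complex)" by (simp add: smooth_def Ck_const)
  then have "bk_L k \<in> vf_generated (bk_L k)"
    unfolding vf_generated_def
    by (intro CollectI exI[of _ "\<lambda>p. 1"]) (simp add: vf_scale_def)
  then have "pushforward \<theta> (bk_L k) \<in> vf_generated (bk_L k)"
    using assms(1) unfolding bk_automorphism_def by blast
  then obtain f where "pushforward \<theta> (bk_L k) = vf_scale f (bk_L k)"
    by (auto simp: vf_generated_def)
  from fun_cong[OF this, of "\<theta> p"]
  have "complexify (D p) (bk_L k p) = vf_scale f (bk_L k) (\<theta> p)"
    by (simp add: pushforward_def inv D_def)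
  then have "Complex (fst (D p (fst p ^ k, 0))) (fst (D p (0, 1))) = f (\<theta> p) * of_real (fst (\<theta> p) ^ k)"
    "Complex (snd (D p (fst p ^ k, 0))) (snd (D p (0, 1))) = f (\<theta> p) * \<i>"
    by (simp_all add: complexify_def bk_L_def vf_scale_def split_beta Let_def)
  \<comment> \<open>The second component expresses f (\<theta> p) through D p; substituting it into
    the first and separating real and imaginary parts eliminates f.\<close>
  then show "fst (D p (fst p ^ k, 0)) = fst (\<theta> p) ^ k * snd (D p (0, 1))"
    "fst (D p (0, 1)) = - (fst (\<theta> p) ^ k) * snd (D p (fst p ^ k, 0))"
    by (simp_all add: complex_eq_iff)
qed

lemma tendsto_at_y_axis:
  fixes \<theta> :: "real \<times> real \<Rightarrow> 'a::topological_space"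
  assumes "continuous_on UNIV \<theta>"
  shows "((\<lambda>x. \<theta> (x, y)) \<longlongrightarrow> \<theta> (0, y)) (at_right 0)"
proof -
  have "continuous_on UNIV (\<lambda>x. \<theta> (x, y))"
    by (rule continuous_on_compose2[OF assms]) (auto intro!: continuous_intros)
  then have "(\<lambda>x. \<theta> (x, y)) \<midarrow>0\<rightarrow> \<theta> (0, y)"
    by (simp add: continuous_on_eq_continuous_at isCont_def)
  then show ?thesis by (rule filterlim_mono[OF _ order_refl at_le]) simp
qed

text \<open>A point of the axis is a limit of points with x > 0, so its image has x \<ge> 0; by
  injectivity the image cannot lie in the open half-plane, which is already the image of
  itself.\<close>

lemma half_plane_preserving_fixes_y_axis:
  assumes "bij \<theta>" "continuous_on UNIV \<theta>" "\<theta> ` right_half_plane = right_half_plane"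
    and "fst p = 0"
  shows "fst (\<theta> p) = 0"
proof -
  have "((\<lambda>x. \<theta> (x, snd p)) \<longlongrightarrow> \<theta> p) (at_right 0)"
    using tendsto_at_y_axis[OF assms(2), of "snd p"] assms(4) by (cases p) simp
  from tendsto_fst[OF this] have "0 \<le> fst (\<theta> p)"
  proof (rule tendsto_lowerbound)
    have "\<theta> (x, snd p) \<in> right_half_plane" if "x > 0" for x
    proof -
      have "(x, snd p) \<in> right_half_plane" using that by (simp add: right_half_plane_def)
      then show ?thesis using assms(3) by blast
    qed
    then show "\<forall>\<^sub>F x in at_right 0. 0 \<le> fst (\<theta> (x, snd p))"
      by (intro eventually_at_right_less[THEN eventually_mono]) (fastforce simp: right_half_plane_def)
  qed simp
  moreover have "p \<notin> right_half_plane"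
    using assms(4) by (auto simp: right_half_plane_def)
  then have "\<theta> p \<notin> right_half_plane"
    using assms(1,3) by (metis bij_is_inj inj_image_mem_iff)
  then have "fst (\<theta> p) \<le> 0"
    by (cases "\<theta> p") (simp add: right_half_plane_def)
  ultimately show ?thesis by simp
qed

text \<open>Both maps are continuous and agree for x > 0, so their limits from the right coincide.
  This carries the formula to the axis, where the two sides are compared.\<close>

lemma affine_auto_eq_on_y_axis:
  assumes "continuous_on UNIV \<theta>"
    and "\<And>p. p \<in> right_half_plane \<Longrightarrow> \<theta> p = affine_auto k t b p"
  shows "\<theta> (0, y) = affine_auto k t b (0, y)"
proof -
  have "continuous_on UNIV (affine_auto k t b)"
    using smooth_affine_auto unfolding smooth_def by (blast intro: Ck_continuous_on)
  note tendsto_at_y_axis[OF this, of y]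
  moreover have "\<forall>\<^sub>F x in at_right 0. affine_auto k t b (x, y) = \<theta> (x, y)"
    by (intro eventually_at_right_less[THEN eventually_mono])
      (simp add: assms(2) right_half_plane_def)
  ultimately have "((\<lambda>x. \<theta> (x, y)) \<longlongrightarrow> affine_auto k t b (0, y)) (at_right 0)"
    by (simp add: tendsto_cong)
  then show ?thesis
    using tendsto_at_y_axis[OF assms(1)] tendsto_unique[OF trivial_limit_at_right_real] by blast
qed

section \<open>Reflection of the left half-plane and gluing along the y-axis\<close>

lemma bk_automorphism_eq_affine_auto:
  assumes k: "k \<ge> 2" and auto: "bk_automorphism k \<theta>"
    and R: "\<theta> ` right_half_plane = right_half_plane"
  obtains t b where "\<theta> = affine_auto k t b"
proof -
  let ?R = right_half_plane
  define D where "D p = frechet_derivative \<theta> (at p)" for p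
  note CR = bk_automorphism_CR[OF auto, folded D_def]
  have \<theta>: "bij \<theta>" "smooth \<theta>" "smooth (inv_into UNIV \<theta>)"
    using auto by (simp_all add: bk_automorphism_def diffeomorphism_def)
  have "Ck (Suc 0) \<theta>" using \<theta>(2) unfolding smooth_def by blast
  then have "\<theta> differentiable (at p)" for p unfolding Ck.simps by blast
  then have D: "(\<theta> has_derivative D p) (at p)" for p
    by (simp add: D_def frechet_derivative_works[symmetric])
  have cont: "continuous_on UNIV \<theta>" "continuous_on UNIV (inv_into UNIV \<theta>)"
    using \<theta> unfolding smooth_def by (blast intro: Ck_continuous_on)+
  have inv_R: "inv_into UNIV \<theta> ` ?R = ?R"
    using R \<theta>(1) by (metis bij_is_inj image_inv_f_f)
  \<comment> \<open>The inverse also preserves the half-plane, which gives the converse; hence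
    \<theta> preserves the axis and each of the two sides.\<close>
  have axis: "fst (\<theta> p) = 0 \<longleftrightarrow> fst p = 0" for p
  proof
    assume "fst (\<theta> p) = 0"
    from half_plane_preserving_fixes_y_axis[OF bij_imp_bij_inv[OF \<theta>(1)] cont(2) inv_R this]
    show "fst p = 0" using \<theta>(1) by (simp add: bij_is_inj)
  qed (rule half_plane_preserving_fixes_y_axis[OF \<theta>(1) cont(1) R])
  have \<theta>R: "fst (\<theta> p) > 0 \<longleftrightarrow> fst p > 0" for p
  proof -
    have "\<theta> p \<in> ?R \<longleftrightarrow> p \<in> ?R"
      using R \<theta>(1) by (metis bij_is_inj inj_image_mem_iff)
    then show ?thesis by (auto simp: right_half_plane_def split_beta)
  qed
  have \<theta>L: "fst (\<theta> p) < 0 \<longleftrightarrow> fst p < 0" for p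
    using axis[of p] \<theta>R[of p] by linarith
  have "((\<lambda>x. fst (\<theta> (x, 0))) \<longlongrightarrow> 0) (at_right 0)"
    using tendsto_fst[OF tendsto_at_y_axis[OF cont(1), of 0]] axis[of "(0, 0)"] by simp
  moreover have "bij_betw \<theta> ?R ?R"
    using R \<theta>(1) by (metis bij_betw_def bij_is_inj inj_on_subset subset_UNIV)
  ultimately obtain t b where right: "\<And>p. p \<in> ?R \<Longrightarrow> \<theta> p = affine_auto k t b p"
    using affine_auto_on_right_half_plane[OF k _ D CR(1) CR(2)] by metis
  \<comment> \<open>This sign makes the reflection \<sigma> map L_k to \<epsilon> L_k: it takes x^k
    \<partial>x to -x^k \<partial>x = \<epsilon> (-x)^k \<partial>x, and \<partial>y to \<epsilon>
    \<partial>y.\<close>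
  define \<epsilon> :: real where "\<epsilon> = (- 1) ^ Suc k"
  have \<epsilon>: "\<epsilon> * \<epsilon> = 1" by (simp add: \<epsilon>_def flip: power_mult_distrib)
  have \<epsilon>_pow: "(- x) ^ k = - \<epsilon> * x ^ k" for x :: real
    by (simp add: \<epsilon>_def power_minus[of x])
  define \<sigma> :: "real \<times> real \<Rightarrow> real \<times> real" where "\<sigma> p = (- fst p, \<epsilon> * snd p)" for p
  have \<sigma>\<sigma>: "\<sigma> (\<sigma> p) = p" for p
    using \<epsilon> by (simp add: \<sigma>_def flip: mult.assoc)
  have \<sigma>_lin: "bounded_linear \<sigma>"
    unfolding \<sigma>_def[abs_def]
    by (intro bounded_linear_Pair bounded_linear_minus bounded_linear_const_mult
        bounded_linear_fst bounded_linear_snd)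
  note d\<sigma> = bounded_linear_imp_has_derivative[OF \<sigma>_lin]
  define \<theta>' where "\<theta>' p = \<sigma> (\<theta> (\<sigma> p))" for p
  define D' where "D' p v = \<sigma> (D (\<sigma> p) (\<sigma> v))" for p v
  have D': "(\<theta>' has_derivative D' p) (at p)" for p
    unfolding \<theta>'_def D'_def
    by (rule has_derivative_compose[OF has_derivative_compose[OF d\<sigma> D] d\<sigma>])
  have D'_eq: "D' p (fst p ^ k, 0) = \<epsilon> *\<^sub>R \<sigma> (D (\<sigma> p) (fst (\<sigma> p) ^ k, 0))"
    "D' p (0, 1) = \<epsilon> *\<^sub>R \<sigma> (D (\<sigma> p) (0, 1))" for p
  proof -
    have "\<sigma> (fst p ^ k, 0) = \<epsilon> *\<^sub>R (fst (\<sigma> p) ^ k, 0)" "\<sigma> (0, 1) = \<epsilon> *\<^sub>R (0, 1)"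
      using \<epsilon> by (simp_all add: \<sigma>_def \<epsilon>_pow flip: mult.assoc)
    then show "D' p (fst p ^ k, 0) = \<epsilon> *\<^sub>R \<sigma> (D (\<sigma> p) (fst (\<sigma> p) ^ k, 0))"
      "D' p (0, 1) = \<epsilon> *\<^sub>R \<sigma> (D (\<sigma> p) (0, 1))"
      by (simp_all only: D'_def linear_cmul[OF has_derivative_linear[OF D]]
          linear_cmul[OF bounded_linear.linear[OF \<sigma>_lin]])
  qed
  have pow': "fst (\<theta>' p) ^ k = - \<epsilon> * fst (\<theta> (\<sigma> p)) ^ k" for p
    by (simp add: \<theta>'_def \<sigma>_def \<epsilon>_pow)
  \<comment> \<open>As \<epsilon> squared is 1, these are the relations of \<theta> at \<sigma> p
    with both sides multiplied by -\<epsilon>.\<close>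
  have CR': "fst (D' p (fst p ^ k, 0)) = fst (\<theta>' p) ^ k * snd (D' p (0, 1))"
    "fst (D' p (0, 1)) = - (fst (\<theta>' p) ^ k) * snd (D' p (fst p ^ k, 0))" for p
    unfolding D'_eq pow' using CR[of "\<sigma> p"] \<epsilon> by (simp_all add: \<sigma>_def flip: mult.assoc)
  have cont': "continuous_on UNIV \<theta>'"
    unfolding \<theta>'_def[abs_def]
    by (intro linear_continuous_on_compose[OF _ bounded_linear.linear[OF \<sigma>_lin]] continuous_on_compose2[OF cont(1)]
        linear_continuous_on[OF \<sigma>_lin]) auto
  have "((\<lambda>x. fst (\<theta>' (x, 0))) \<longlongrightarrow> 0) (at_right 0)"
    using tendsto_fst[OF tendsto_at_y_axis[OF cont', of 0]] axis[of "(0, 0)"]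
    by (simp add: \<theta>'_def \<sigma>_def)
  moreover have "bij_betw \<theta>' ?R ?R"
  \<comment> \<open>The inverse is the reflected inverse of \<theta>; both map x > 0 to itself
    because \<theta> preserves x < 0.\<close>
  proof (rule bij_betw_byWitness[where f' = "\<lambda>p. \<sigma> (inv_into UNIV \<theta> (\<sigma> p))"])
    have inv: "inv_into UNIV \<theta> (\<theta> p) = p" "\<theta> (inv_into UNIV \<theta> p) = p" for p
      using \<theta>(1) by (simp_all add: bij_is_inj bij_is_surj surj_f_inv_f)
    have R\<sigma>: "p \<in> ?R \<longleftrightarrow> fst (\<sigma> p) < 0" for p
      by (auto simp: \<sigma>_def right_half_plane_def split_beta)
    show "\<forall>p\<in>?R. \<sigma> (inv_into UNIV \<theta> (\<sigma> (\<theta>' p))) = p"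
      "\<forall>p\<in>?R. \<theta>' (\<sigma> (inv_into UNIV \<theta> (\<sigma> p))) = p"
      by (simp_all add: \<theta>'_def \<sigma>\<sigma> inv)
    show "\<theta>' ` ?R \<subseteq> ?R" by (auto simp: R\<sigma> \<theta>'_def \<sigma>\<sigma> \<theta>L)
    show "(\<lambda>p. \<sigma> (inv_into UNIV \<theta> (\<sigma> p))) ` ?R \<subseteq> ?R"
    proof (rule image_subsetI)
      fix p assume "p \<in> ?R"
      then show "\<sigma> (inv_into UNIV \<theta> (\<sigma> p)) \<in> ?R"
        using \<theta>L[of "inv_into UNIV \<theta> (\<sigma> p)"] by (simp add: R\<sigma> \<sigma>\<sigma> inv)
    qed
  qed
  ultimately obtain t' b' where left: "\<And>p. p \<in> ?R \<Longrightarrow> \<theta>' p = affine_auto k t' b' p"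
    using affine_auto_on_right_half_plane[OF k _ D' CR'(1) CR'(2)] by metis
  note axis_right = affine_auto_eq_on_y_axis[OF cont(1) right]
    and axis_left = affine_auto_eq_on_y_axis[OF cont' left]
  \<comment> \<open>Both formulas hold on the axis, which \<sigma> maps to itself. The value y = 0
    gives b' = \<epsilon> b, and then y = 1 gives exp t' = exp t.\<close>
  have "\<epsilon> * (exp t * (\<epsilon> * y) + b) = exp t' * y + b'" for y
    using axis_left[of y] axis_right[of "\<epsilon> * y"] by (simp add: \<theta>'_def \<sigma>_def affine_auto_def)
  note this[of 0] this[of 1]
  then have b': "b' = \<epsilon> * b" and "\<epsilon> * \<epsilon> * exp t = exp t'"
    by (simp_all add: algebra_simps)
  then have t': "t' = t" using \<epsilon> by simp
  show thesis
  proof (rule that[of t b], rule ext)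
    fix p :: "real \<times> real"
    consider "fst p > 0" | "fst p = 0" | "fst p < 0" using less_linear[of "fst p" 0] by auto
    then show "\<theta> p = affine_auto k t b p"
    proof cases
      case 1
      then show ?thesis by (intro right) (auto simp: right_half_plane_def split_beta)
    next
      case 2
      then show ?thesis using axis_right[of "snd p"] by (cases p) simp
    next
      case 3
      then have "\<sigma> p \<in> ?R" by (simp add: \<sigma>_def right_half_plane_def)
      have "\<theta> p = \<sigma> (\<theta>' (\<sigma> p))" by (simp add: \<theta>'_def \<sigma>\<sigma>)
      also have "\<dots> = \<sigma> (affine_auto k t (\<epsilon> * b) (\<sigma> p))"
        using left[OF \<open>\<sigma> p \<in> ?R\<close>] by (simp add: t' b')
      also have "\<dots> = (exp (- t / (real k - 1)) * fst p, \<epsilon> * \<epsilon> * (exp t * snd p + b))"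
        by (simp add: \<sigma>_def affine_auto_def algebra_simps)
      finally show ?thesis using \<epsilon> by (simp add: affine_auto_def split_beta)
    qed
  qed
qed

section \<open>The group structure\<close>

lemma carrier_bk_Aut_plus:
  assumes "k \<ge> 2"
  shows "carrier (bk_Aut_plus k) = range (\<lambda>(t, b). affine_auto k t b)"
proof
  show "carrier (bk_Aut_plus k) \<subseteq> range (\<lambda>(t, b). affine_auto k t b)"
  proof
    fix \<theta> assume "\<theta> \<in> carrier (bk_Aut_plus k)"
    then have "bk_automorphism k \<theta>" "\<theta> ` right_half_plane = right_half_plane"
      by (simp_all add: bk_Aut_plus_def bk_Aut_def)
    from bk_automorphism_eq_affine_auto[OF assms this] obtain t b where "\<theta> = affine_auto k t b" .
    then show "\<theta> \<in> range (\<lambda>(t, b). affine_auto k t b)" by auto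
  qed
  show "range (\<lambda>(t, b). affine_auto k t b) \<subseteq> carrier (bk_Aut_plus k)"
  proof -
    have "affine_auto k t b \<in> carrier (bk_Aut_plus k)" for t b
      by (simp add: bk_Aut_plus_def bk_Aut_def bk_automorphism_affine_auto[OF assms]
          affine_auto_right_half_plane)
    then show ?thesis by auto
  qed
qed

lemma mult_bk_Aut_plus [simp]: "mult (bk_Aut_plus k) = (\<circ>)"
  and one_bk_Aut_plus [simp]: "one (bk_Aut_plus k) = id"
  by (simp_all add: bk_Aut_plus_def bk_Aut_def)

text \<open>True for every k, because t = 0 makes both scalings trivial; uses of it therefore have
  to name k.\<close>

lemma vertical_translation_eq: "vertical_translation b = affine_auto k 0 b"
  by (simp add: vertical_translation_def affine_auto_def)

lemma hyperbolic_eq: "hyperbolic k t = affine_auto k t 0"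
  by (simp add: hyperbolic_def affine_auto_def)

theorem theorem7p5:
  fixes k :: nat
  assumes "k \<ge> 2"
  shows "group (bk_Aut_plus k) \<and>
    bk_Aut_plus k \<cong> axb_group \<and>
    vertical_translation \<in> hom real_additive_group (bk_Aut_plus k) \<and>
    hyperbolic k \<in> hom real_additive_group (bk_Aut_plus k) \<and>
    generate (bk_Aut_plus k) (range vertical_translation \<union> range (hyperbolic k))
      = carrier (bk_Aut_plus k)"
proof (intro conjI)
  let ?G = "bk_Aut_plus k"
  note carrier = carrier_bk_Aut_plus[OF assms]
  have mem: "affine_auto k t b \<in> carrier ?G" for t b
    unfolding carrier by auto
  have memE: "\<exists>t b. \<theta> = affine_auto k t b" if "\<theta> \<in> carrier ?G" for \<theta>
    using that unfolding carrier by auto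
  show group: "group ?G"
  proof (rule groupI)
    fix \<theta> \<eta> assume "\<theta> \<in> carrier ?G" "\<eta> \<in> carrier ?G"
    then show "\<theta> \<otimes>\<^bsub>?G\<^esub> \<eta> \<in> carrier ?G"
      using memE mem affine_auto_comp by (metis mult_bk_Aut_plus)
  next
    show "\<one>\<^bsub>?G\<^esub> \<in> carrier ?G"
      using mem[of 0 0] by (simp add: affine_auto_0)
  next
    fix \<theta> assume "\<theta> \<in> carrier ?G"
    then obtain t b where "\<theta> = affine_auto k t b" using memE by blast
    then have "affine_auto k (- t) (- (exp (- t) * b)) \<otimes>\<^bsub>?G\<^esub> \<theta> = \<one>\<^bsub>?G\<^esub>"
      by (simp add: fun_eq_iff affine_auto_inverse)
    then show "\<exists>\<eta>\<in>carrier ?G. \<eta> \<otimes>\<^bsub>?G\<^esub> \<theta> = \<one>\<^bsub>?G\<^esub>" using mem by blast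
  qed (simp_all add: o_assoc)
  show "?G \<cong> axb_group"
  proof -
    \<comment> \<open>An element of the group acts on the y-axis by s \<mapsto> exp t * s + b;
      \<open>h\<close> reads the two coefficients off the images of s = 0 and s = 1.\<close>
    define h :: "(real \<times> real \<Rightarrow> real \<times> real) \<Rightarrow> real \<times> real"
      where "h \<theta> = (snd (\<theta> (0, 1)) - snd (\<theta> (0, 0)), snd (\<theta> (0, 0)))" for \<theta>
    have h: "h (affine_auto k t b) = (exp t, b)" for t b
      by (simp add: h_def affine_auto_def)
    have "h \<in> hom ?G axb_group"
    proof (rule homI)
      fix \<theta> \<eta> assume "\<theta> \<in> carrier ?G" "\<eta> \<in> carrier ?G"
      then obtain t b t' b' where "\<theta> = affine_auto k t b" "\<eta> = affine_auto k t' b'"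
        using memE by blast
      then show "h (\<theta> \<otimes>\<^bsub>?G\<^esub> \<eta>) = h \<theta> \<otimes>\<^bsub>axb_group\<^esub> h \<eta>"
        by (simp add: affine_auto_comp h axb_group_def exp_add)
    qed (use h memE in \<open>force simp: axb_group_def\<close>)
    moreover have "bij_betw h (carrier ?G) (carrier axb_group)"
      unfolding bij_betw_def
    proof
      show "inj_on h (carrier ?G)"
        unfolding carrier by (auto simp: inj_on_def h)
      have "(a, b) \<in> h ` carrier ?G" if "a > 0" for a b
        using h[of "ln a" b] mem[of "ln a" b] that by (metis exp_ln image_eqI)
      then show "h ` carrier ?G = carrier axb_group"
        using h memE by (force simp: axb_group_def)
    qed
    ultimately show ?thesis unfolding is_iso_def using isoI by blast
  qed
  show "vertical_translation \<in> hom real_additive_group ?G"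
    by (rule homI) (simp_all add: vertical_translation_eq[of _ k] mem affine_auto_comp
        real_additive_group_def add.commute)
  show "hyperbolic k \<in> hom real_additive_group ?G"
    by (rule homI) (simp_all add: hyperbolic_eq mem affine_auto_comp real_additive_group_def)
  let ?S = "range vertical_translation \<union> range (hyperbolic k)"
  have S: "?S \<subseteq> carrier ?G"
    using mem by (auto simp: vertical_translation_eq[of _ k] hyperbolic_eq)
  show "generate ?G ?S = carrier ?G"
  proof
    show "generate ?G ?S \<subseteq> carrier ?G"
      by (rule group.generate_incl[OF group S])
    show "carrier ?G \<subseteq> generate ?G ?S"
    proof
      fix \<theta> assume "\<theta> \<in> carrier ?G"
      then obtain t b where "\<theta> = affine_auto k t b" using memE by blast
      \<comment> \<open>Every element is a product of just two generators.\<close>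
      then have "\<theta> = vertical_translation b \<otimes>\<^bsub>?G\<^esub> hyperbolic k t"
        by (simp add: vertical_translation_eq[of _ k] hyperbolic_eq affine_auto_comp)
      also have "\<dots> \<in> generate ?G ?S"
        by (intro generate.eng generate.incl) auto
      finally show "\<theta> \<in> generate ?G ?S" .
    qed
  qed
qed

end
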